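(* Let $\alpha$ and $\beta$ be trivial automorphisms of $\mathcal P(\mathbb N)/\mathrm{Fin}$. If $\mathrm{par}(\alpha)\neq\mathrm{par}(\beta)$, then $\alpha$ and $\beta$ are not conjugate.
   Context: $\mathcal P(\mathbb N)/\mathrm{Fin}$ is the Boolean algebra of subsets of $\mathbb N$ modulo the ideal of finite sets; $[A]_{\mathrm{Fin}}$ denotes the class of $A\subseteq\mathbb N$. An almost permutation of $\mathbb N$ is a bijection $f$ between two cofinite subsets $\mathrm{dom}(f)$ and $\mathrm{ran}(f)$ of $\mathbb N$; it induces the automorphism $\alpha_f([A]_{\mathrm{Fin}})=[f[A]]_{\mathrm{Fin}}$ of $\mathcal P(\mathbb N)/\mathrm{Fin}$. Automorphisms of this form are called trivial. The index of an almost permutation $f$ is $\mathrm{Index}(f)=|\mathbb N\setminus\mathrm{dom}(f)|-|\mathbb N\setminus\mathrm{ran}(f)|$; it depends only on $\alpha_f$, and the parity $\mathrm{par}(\alpha_f)$ is $0$ if $\mathrm{Index}(f)$ is even and $1$ if it is odd. Two automorphisms $\alpha,\beta$ of $\mathcal P(\mathbb N)/\mathrm{Fin}$ are conjugate if there is an automorphism $\gamma$ of $\mathcal P(\mathbb N)/\mathrm{Fin}$ (not necessarily trivial) with $\gamma\circ\alpha=\beta\circ\gamma$. This is a theorem of ZFC. *)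

theory Defs
  imports Main
begin

definition eq_fin :: "nat set \<Rightarrow> nat set \<Rightarrow> bool" where
  "eq_fin A B \<longleftrightarrow> finite ((A - B) \<union> (B - A))"

lemma equivp_eq_fin: "equivp eq_fin"
proof (rule equivpI)
  show "reflp eq_fin" by (simp add: reflp_def eq_fin_def)
  show "symp eq_fin" by (auto simp: symp_def eq_fin_def)
  show "transp eq_fin"
  proof (rule transpI)
    fix A B C assume "eq_fin A B" "eq_fin B C"
    then have "finite (((A - B) \<union> (B - A)) \<union> ((B - C) \<union> (C - B)))"
      by (simp add: eq_fin_def)
    then show "eq_fin A C"
      unfolding eq_fin_def by (rule rev_finite_subset) blast
  qed
qed

text \<open>The Boolean algebra of sets of natural numbers modulo finite sets; \<open>fin_class A\<close> is the class
  of \<open>A\<close>.\<close>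

quotient_type pnat_fin = "nat set" / eq_fin
  morphisms rep_pnat_fin fin_class
  by (rule equivp_eq_fin)

instantiation pnat_fin :: boolean_algebra
begin

lift_definition bot_pnat_fin :: pnat_fin is "{}" .

lift_definition top_pnat_fin :: pnat_fin is "UNIV" .

lift_definition inf_pnat_fin :: "pnat_fin \<Rightarrow> pnat_fin \<Rightarrow> pnat_fin" is "(\<inter>)"
  unfolding eq_fin_def by (erule (1) finite_subset[rotated, OF finite_UnI]) blast

lift_definition sup_pnat_fin :: "pnat_fin \<Rightarrow> pnat_fin \<Rightarrow> pnat_fin" is "(\<union>)"
  unfolding eq_fin_def by (erule (1) finite_subset[rotated, OF finite_UnI]) blast

lift_definition minus_pnat_fin :: "pnat_fin \<Rightarrow> pnat_fin \<Rightarrow> pnat_fin" is "(-)"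
  unfolding eq_fin_def by (erule (1) finite_subset[rotated, OF finite_UnI]) blast

lift_definition uminus_pnat_fin :: "pnat_fin \<Rightarrow> pnat_fin" is "uminus"
  unfolding eq_fin_def by (erule finite_subset[rotated]) blast

lift_definition less_eq_pnat_fin :: "pnat_fin \<Rightarrow> pnat_fin \<Rightarrow> bool" is "\<lambda>A B. finite (A - B)"
proof -
  fix A A' B B' assume *: "eq_fin A A'" "eq_fin B B'"
  have "finite (A' - B')" if "finite (A - B)"
    using * that unfolding eq_fin_def
    by (intro finite_subset[of "A' - B'" "(A - B) \<union> (A' - A) \<union> (B - B')"]) auto
  moreover have "finite (A - B)" if "finite (A' - B')"
    using * that unfolding eq_fin_def
    by (intro finite_subset[of "A - B" "(A' - B') \<union> (A - A') \<union> (B' - B)"]) auto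
  ultimately show "finite (A - B) = finite (A' - B')" by blast
qed

definition less_pnat_fin :: "pnat_fin \<Rightarrow> pnat_fin \<Rightarrow> bool" where
  "less_pnat_fin x y \<longleftrightarrow> x \<le> y \<and> \<not> y \<le> x"

instance
proof
  fix x y z :: pnat_fin
  show "x < y \<longleftrightarrow> x \<le> y \<and> \<not> y \<le> x" by (simp add: less_pnat_fin_def)
  show "x \<le> x" by transfer simp
  show "x \<le> y \<Longrightarrow> y \<le> z \<Longrightarrow> x \<le> z"
  proof transfer
    fix A B C :: "nat set" assume "finite (A - B)" "finite (B - C)"
    then show "finite (A - C)"
      by (intro finite_subset[of "A - C" "(A - B) \<union> (B - C)"]) auto
  qed
  show "x \<le> y \<Longrightarrow> y \<le> x \<Longrightarrow> x = y" by transfer (simp add: eq_fin_def)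
  show "inf x y \<le> x" by transfer (simp add: Diff_eq Int_ac)
  show "inf x y \<le> y" by transfer (simp add: Diff_eq Int_ac)
  show "x \<le> y \<Longrightarrow> x \<le> z \<Longrightarrow> x \<le> inf y z" by transfer (simp add: Diff_Int)
  show "x \<le> sup x y" by transfer (simp add: Diff_eq Int_ac)
  show "y \<le> sup x y" by transfer (simp add: Diff_eq Int_ac)
  show "y \<le> x \<Longrightarrow> z \<le> x \<Longrightarrow> sup y z \<le> x" by transfer (simp add: Un_Diff)
  show "bot \<le> x" by transfer simp
  show "x \<le> top" by transfer simp
  show "sup x (inf y z) = inf (sup x y) (sup x z)"
    by transfer (simp add: Un_Int_distrib eq_fin_def)
  show "inf x (- x) = bot" by transfer (simp add: eq_fin_def)
  show "sup x (- x) = top" by transfer (simp add: eq_fin_def)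
  show "x - y = inf x (- y)" by transfer (simp add: Diff_eq eq_fin_def)
qed

end

definition boolean_automorphism :: "('a::boolean_algebra \<Rightarrow> 'a) \<Rightarrow> bool" where
  "boolean_automorphism \<alpha> \<longleftrightarrow> bij \<alpha> \<and>
     (\<forall>x y. \<alpha> (inf x y) = inf (\<alpha> x) (\<alpha> y)) \<and>
     (\<forall>x y. \<alpha> (sup x y) = sup (\<alpha> x) (\<alpha> y)) \<and>
     (\<forall>x. \<alpha> (- x) = - \<alpha> x) \<and> \<alpha> bot = bot \<and> \<alpha> top = top"

definition conjugate :: "('a::boolean_algebra \<Rightarrow> 'a) \<Rightarrow> ('a \<Rightarrow> 'a) \<Rightarrow> bool" where
  "conjugate \<alpha> \<beta> \<longleftrightarrow> (\<exists>\<gamma>. boolean_automorphism \<gamma> \<and> \<gamma> \<circ> \<alpha> = \<beta> \<circ> \<gamma>)"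

definition almost_permutation :: "(nat \<rightharpoonup> nat) \<Rightarrow> bool" where
  "almost_permutation f \<longleftrightarrow> finite (- dom f) \<and> finite (- ran f) \<and> inj_on f (dom f)"

text \<open>The set \<open>ran (f |` A)\<close> is the image of \<open>A \<inter> dom f\<close> under the partial function \<open>f\<close>.
  Lifting to classes does not need \<open>f\<close> to be an almost permutation.\<close>

lift_definition induced :: "(nat \<rightharpoonup> nat) \<Rightarrow> pnat_fin \<Rightarrow> pnat_fin" is "\<lambda>f A. ran (f |` A)"
proof -
  fix f :: "nat \<rightharpoonup> nat" and A B assume "eq_fin A B"
  then have "finite ((\<lambda>n. the (f n)) ` ((A - B) \<union> (B - A)))"
    unfolding eq_fin_def by (rule finite_imageI)
  then show "eq_fin (ran (f |` A)) (ran (f |` B))"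
    unfolding eq_fin_def
    by (rule rev_finite_subset) (force simp: ran_def restrict_map_def split: if_splits)
qed

definition trivial_automorphism :: "(pnat_fin \<Rightarrow> pnat_fin) \<Rightarrow> bool" where
  "trivial_automorphism \<alpha> \<longleftrightarrow> (\<exists>f. almost_permutation f \<and> \<alpha> = induced f)"

definition index :: "(nat \<rightharpoonup> nat) \<Rightarrow> int" where
  "index f = int (card (- dom f)) - int (card (- ran f))"

text \<open>Well defined on trivial automorphisms, because the index of an almost permutation depends only
  on the automorphism it induces; unspecified on other maps.\<close>

definition par :: "(pnat_fin \<Rightarrow> pnat_fin) \<Rightarrow> nat" where
  "par \<alpha> = (THE p. \<exists>f. almost_permutation f \<and> \<alpha> = induced f \<and> p = (if even (index f) then 0 else 1))"

lemma ran_restrict_iff: "y \<in> ran (f |` A) \<longleftrightarrow> (\<exists>x\<in>A. f x = Some y)"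
  by (auto simp: ran_def restrict_map_def split: if_splits)

lemma boolean_automorphism_induced:
  assumes "almost_permutation f"
  shows "boolean_automorphism (induced f)"
proof -
  have fd: "finite (- dom f)" and fr: "finite (- ran f)" and inj: "inj_on f (dom f)"
    using assms by (auto simp: almost_permutation_def)
  have inj': "x = x'" if "f x = Some y" "f x' = Some y" for x x' y
    using inj that by (auto simp: inj_on_def dom_def)
  have 1: "induced f (inf x y) = inf (induced f x) (induced f y)" for x y
  proof (transfer fixing: f)
    fix A B :: "nat set"
    have "ran (f |` (A \<inter> B)) = ran (f |` A) \<inter> ran (f |` B)"
      unfolding set_eq_iff Int_iff ran_restrict_iff using inj' by blast
    then show "eq_fin (ran (f |` (A \<inter> B))) (ran (f |` A) \<inter> ran (f |` B))"
      by (simp add: eq_fin_def)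
  qed
  have 2: "induced f (sup x y) = sup (induced f x) (induced f y)" for x y
  proof (transfer fixing: f)
    fix A B :: "nat set"
    have "ran (f |` (A \<union> B)) = ran (f |` A) \<union> ran (f |` B)"
      by (auto simp: ran_restrict_iff)
    then show "eq_fin (ran (f |` (A \<union> B))) (ran (f |` A) \<union> ran (f |` B))"
      by (simp add: eq_fin_def)
  qed
  have 3: "induced f (- x) = - induced f x" for x
  proof (transfer fixing: f)
    fix A :: "nat set"
    have "ran (f |` (- A)) \<subseteq> - ran (f |` A)"
      unfolding subset_iff Compl_iff ran_restrict_iff proof (intro allI impI notI)
      fix y assume "\<exists>x\<in>- A. f x = Some y" "\<exists>x\<in>A. f x = Some y"
      then obtain x x' where "x \<notin> A" "f x = Some y" "x' \<in> A" "f x' = Some y" by blast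
      then show False using inj' by blast
    qed
    moreover have "- ran (f |` A) - ran (f |` (- A)) \<subseteq> - ran f"
    proof
      fix y assume "y \<in> - ran (f |` A) - ran (f |` (- A))"
      then have "f x \<noteq> Some y" for x by (cases "x \<in> A") (auto simp: ran_restrict_iff)
      then show "y \<in> - ran f" by (auto simp: ran_def)
    qed
    ultimately have "(ran (f |` (- A)) - (- ran (f |` A))) \<union> (- ran (f |` A) - ran (f |` (- A))) \<subseteq> - ran f"
      by blast
    then show "eq_fin (ran (f |` (- A))) (- ran (f |` A))"
      unfolding eq_fin_def by (rule finite_subset[OF _ fr])
  qed
  have 4: "induced f bot = bot" by (transfer fixing: f) (simp add: eq_fin_def)
  have 5: "induced f top = top" using 3[of bot] 4 by simp
  have "inj (induced f)"
  proof (rule injI)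
    fix x y assume "induced f x = induced f y"
    then show "x = y"
    proof (transfer fixing: f)
      fix A B :: "nat set"
      let ?D = "\<lambda>A B. (A - B) \<union> (B - A)"
      assume "eq_fin (ran (f |` A)) (ran (f |` B))"
      then have fin: "finite (?D (ran (f |` A)) (ran (f |` B)))" by (simp add: eq_fin_def)
      have "(\<lambda>n. the (f n)) ` (?D A B \<inter> dom f) \<subseteq> ?D (ran (f |` A)) (ran (f |` B))"
      proof
        fix y assume "y \<in> (\<lambda>n. the (f n)) ` (?D A B \<inter> dom f)"
        then obtain n where "n \<in> ?D A B \<inter> dom f" "y = the (f n)" by blast
        then have n: "n \<in> ?D A B" "f n = Some y" by auto
        have "y \<in> ran (f |` C) \<longleftrightarrow> n \<in> C" for C
          unfolding ran_restrict_iff using inj' n(2) by metis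
        then show "y \<in> ?D (ran (f |` A)) (ran (f |` B))"
          using n(1) by simp
      qed
      moreover have "inj_on (\<lambda>n. the (f n)) (?D A B \<inter> dom f)"
      proof (rule inj_onI)
        fix m n assume "m \<in> ?D A B \<inter> dom f" "n \<in> ?D A B \<inter> dom f" "the (f m) = the (f n)"
        then have "f m = Some (the (f m))" "f n = Some (the (f m))" by auto
        then show "m = n" by (rule inj')
      qed
      ultimately have "finite (?D A B \<inter> dom f)"
        using fin by (metis inj_on_finite)
      then have "finite ((?D A B \<inter> dom f) \<union> - dom f)" using fd by blast
      then show "eq_fin A B" unfolding eq_fin_def by (rule rev_finite_subset) blast
    qed
  qed
  moreover have "surj (induced f)"
  proof (unfold surj_def, intro allI)
    fix y
    obtain B where y: "y = fin_class B" by (induct y rule: pnat_fin.abs_induct) blast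
    have "ran (f |` {n. \<exists>m\<in>B. f n = Some m}) = B \<inter> ran f"
      by (auto simp: set_eq_iff ran_restrict_iff) (auto simp: ran_def)
    moreover have "finite (B \<inter> ran f - B)" by (rule finite_subset[of _ "{}"]) auto
    moreover have "finite (B - ran f)" using fr by (rule rev_finite_subset) blast
    ultimately have "eq_fin (ran (f |` {n. \<exists>m\<in>B. f n = Some m})) B"
      by (simp add: eq_fin_def Diff_Int)
    then have "y = induced f (fin_class {n. \<exists>m\<in>B. f n = Some m})"
      by (simp add: y induced.abs_eq pnat_fin.abs_eq_iff eq_fin_def Un_commute)
    then show "\<exists>x. y = induced f x" ..
  qed
  ultimately show ?thesis
    using 1 2 3 4 5 unfolding boolean_automorphism_def bij_def by blast
qed

lemma eventually_equal_if_induced_eq: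
  assumes f: "almost_permutation f" and g: "almost_permutation g" and eq: "induced f = induced g"
  shows "finite {n. f n \<noteq> g n}"
proof (rule ccontr)
  assume inf0: "infinite {n. f n \<noteq> g n}"
  define D where "D = {n. f n \<noteq> g n} \<inter> dom f \<inter> dom g"
  have "{n. f n \<noteq> g n} \<subseteq> D \<union> - dom f \<union> - dom g" unfolding D_def by blast
  moreover have "finite (- dom f)" "finite (- dom g)"
    using f g by (auto simp: almost_permutation_def)
  ultimately have infD: "infinite D" using inf0 by (meson finite_Un finite_subset)
  define C where "C = {A. A \<subseteq> D \<and> (\<forall>x\<in>A. \<forall>y\<in>A. f x \<noteq> g y)}"
  have "\<exists>A\<in>C. \<forall>X\<in>C. A \<subseteq> X \<longrightarrow> X = A"
  proof (rule subset_Zorn')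
    fix c assume c: "subset.chain C c"
    then have sub: "c \<subseteq> C" and tot: "\<And>X Y. X \<in> c \<Longrightarrow> Y \<in> c \<Longrightarrow> X \<subseteq> Y \<or> Y \<subseteq> X"
      by (auto simp: subset_chain_def)
    have "f x \<noteq> g y" if "x \<in> X" "X \<in> c" "y \<in> Y" "Y \<in> c" for x y X Y
      using tot[OF that(2,4)] that sub unfolding C_def by blast
    moreover have "\<Union>c \<subseteq> D" using sub unfolding C_def by blast
    ultimately show "\<Union>c \<in> C" unfolding C_def by blast
  qed
  then obtain A where A: "A \<in> C" and max: "\<And>X. X \<in> C \<Longrightarrow> A \<subseteq> X \<Longrightarrow> X = A" by blast
  have injf: "inj_on f D" and injg: "inj_on g D"
    using f g by (auto simp: almost_permutation_def D_def intro: inj_on_subset)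
  have infA: "infinite A"
  proof
    assume "finite A"
    then have "finite (f -` g ` A \<inter> D)" "finite (g -` f ` A \<inter> D)"
      using injf injg by (auto intro: finite_vimage_IntI)
    then have "finite (A \<union> (f -` g ` A \<inter> D) \<union> (g -` f ` A \<inter> D))" using \<open>finite A\<close> by blast
    then obtain n where n: "n \<in> D" "n \<notin> A \<union> (f -` g ` A \<inter> D) \<union> (g -` f ` A \<inter> D)"
      using infD by (meson finite_subset subsetI)
    have "f n \<noteq> g n" using n(1) by (simp add: D_def)
    moreover have "f n \<noteq> g a" "g n \<noteq> f a" if "a \<in> A" for a
      using n that by blast+
    ultimately have "insert n A \<in> C"
      using A n(1) unfolding C_def by fastforce
    from max[OF this] n(2) show False by blast
  qed
  have "induced f (fin_class A) = induced g (fin_class A)" using eq by simp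
  then have "eq_fin (ran (f |` A)) (ran (g |` A))"
    by (simp add: induced.abs_eq pnat_fin.abs_eq_iff)
  moreover have "ran (f |` A) - ran (g |` A) = ran (f |` A)"
    using A unfolding C_def set_eq_iff Diff_iff ran_restrict_iff by fastforce
  ultimately have "finite (ran (f |` A))" by (simp add: eq_fin_def)
  moreover have "f ` A \<subseteq> Some ` ran (f |` A)"
    using A by (fastforce simp: C_def D_def ran_restrict_iff)
  ultimately have "finite (f ` A)" using finite_subset by blast
  moreover have "inj_on f A" using injf A inj_on_subset by (auto simp: C_def)
  ultimately show False using infA finite_imageD by blast
qed

lemma index_restrict:
  assumes f: "almost_permutation f" and E: "E \<subseteq> dom f" "finite (- E)"
  shows "index f = int (card (- E)) - int (card (- ran (f |` E)))"
proof -
  define h where "h n = the (f n)" for n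
  have fd: "finite (- dom f)" and fr: "finite (- ran f)" and inj: "inj_on f (dom f)"
    using f by (auto simp: almost_permutation_def)
  have injh: "inj_on h (dom f - E)" using inj by (auto simp: h_def inj_on_def dom_def)
  have fin: "finite (dom f - E)" using E(2) by (rule rev_finite_subset) blast
  have 1: "- E = - dom f \<union> (dom f - E)" using E(1) by blast
  have a: "h n \<in> ran f" if "n \<in> dom f" for n using that by (auto simp: h_def ran_def)
  have b: "h n \<notin> ran (f |` E)" if "n \<in> dom f - E" for n
  proof
    assume "h n \<in> ran (f |` E)"
    then obtain x where "x \<in> E" "f x = Some (h n)" by (auto simp: ran_restrict_iff)
    moreover have "f n = Some (h n)" using that by (auto simp: h_def)
    ultimately have "x \<in> E" "f x = f n" by simp_all
    then have "x = n" using inj_onD[OF inj, of x n] E(1) that by blast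
    then show False using \<open>x \<in> E\<close> that by blast
  qed
  have c: "y \<in> h ` (dom f - E)" if "y \<in> ran f" "y \<notin> ran (f |` E)" for y
  proof -
    from that(1) obtain x where x: "f x = Some y" by (auto simp: ran_def)
    then have "x \<notin> E" using that(2) by (auto simp: ran_restrict_iff)
    then show ?thesis using x by (force simp: h_def)
  qed
  have "ran (f |` E) \<subseteq> ran f" by (auto simp: ran_def restrict_map_def split: if_splits)
  then have 2: "- ran (f |` E) = - ran f \<union> h ` (dom f - E)"
    by (intro equalityI subsetI) (use b c in auto)
  have 3: "- ran f \<inter> h ` (dom f - E) = {}" using a by auto
  have "card (- E) = card (- dom f) + card (dom f - E)"
    unfolding 1 using fd fin by (intro card_Un_disjoint) auto
  moreover have "card (- ran (f |` E)) = card (- ran f) + card (dom f - E)"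
    unfolding 2 card_image[OF injh, symmetric] using fr fin 3 by (intro card_Un_disjoint) auto
  ultimately show ?thesis by (simp add: index_def)
qed

lemma index_eq_if_induced_eq:
  assumes f: "almost_permutation f" and g: "almost_permutation g" and eq: "induced f = induced g"
  shows "index f = index g"
proof -
  define E where "E = {n. f n = g n} \<inter> dom f"
  have "- E = {n. f n \<noteq> g n} \<union> - dom f" by (auto simp: E_def)
  then have fin: "finite (- E)"
    using eventually_equal_if_induced_eq[OF assms] f by (simp add: almost_permutation_def)
  have "E \<subseteq> dom f" "E \<subseteq> dom g" by (auto simp: E_def dom_def) metis
  moreover have "f |` E = g |` E" by (auto simp: E_def restrict_map_def)
  ultimately show ?thesis using index_restrict[OF f _ fin] index_restrict[OF g _ fin] by simp
qed

lemma par_induced: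
  assumes "almost_permutation f"
  shows "par (induced f) = (if even (index f) then 0 else 1)"
  unfolding par_def
proof (rule the_equality)
  fix p
  assume "\<exists>g. almost_permutation g \<and> induced f = induced g \<and> p = (if even (index g) then 0 else 1)"
  then show "p = (if even (index f) then 0 else 1)"
    using index_eq_if_induced_eq[OF assms] by metis
qed (use assms in blast)

end

theory Submission
  imports Defs "HOL-Library.Ramsey" "HOL-Library.Countable_Set"
begin

text \<open>A conjugacy from \<open>\<alpha>\<close> to \<open>\<beta>\<close> carries the algebra of elements fixed by \<open>\<alpha>\<close> onto that of \<open>\<beta>\<close>,
  hence atoms onto atoms. The fixed algebra does not change when \<open>\<alpha>\<close> is inverted, so we may assume
  that \<open>\<alpha>\<close> is induced by an injection \<open>h\<close> of the natural numbers with cofinite range. The atoms are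
  then the ends of the infinite orbits of \<open>h\<close>: an orbit of type \<open>\<int>\<close> has two ends, and an orbit
  starting at a point outside the range of \<open>h\<close> has one. Let \<open>M\<close> be the involution exchanging the
  two ends of each orbit; its fixed points are counted by the complement of the range of \<open>h\<close>, so their
  number has the parity of \<open>\<alpha>\<close>. Every \<open>M\<close>-closed set of ends is the set of ends below some fixed
  element, and every fixed element separates only finitely many ends from their partners. Transporting
  the involution of \<open>\<beta>\<close> back along the conjugacy thus gives an involution \<open>N\<close> such that no \<open>M\<close>-closed
  set is cut by \<open>N\<close> infinitely often. By Ramsey's theorem \<open>M\<close> and \<open>N\<close> then differ only on
  a finite set, which both preserve, so their numbers of fixed points have the same parity.\<close>

section \<open>Parity of the fixed points of involutions\<close>

text \<open>The points moved by \<open>M\<close> fall into two-element cycles; the induction removes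
  one such cycle at a time.\<close>

lemma even_card_involution:
  assumes "finite D" "\<And>x. x \<in> D \<Longrightarrow> M x \<in> D" "\<And>x. x \<in> D \<Longrightarrow> M (M x) = x"
  shows "even (card D) \<longleftrightarrow> even (card {x \<in> D. M x = x})"
  using assms
proof (induction "card D" arbitrary: D rule: less_induct)
  case less
  show ?case
  proof (cases "\<exists>x\<in>D. M x \<noteq> x")
    case False
    then have "{x \<in> D. M x = x} = D" by blast
    then show ?thesis by simp
  next
    case True
    then obtain x where x: "x \<in> D" "M x \<noteq> x" by blast
    let ?E = "D - {x, M x}"
    have E: "M y \<in> ?E" if "y \<in> ?E" for y
      using that less.prems(2,3) x by (metis DiffD1 DiffD2 DiffI insert_iff singletonD)
    have sub: "{x, M x} \<subseteq> D" using x less.prems by blast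
    then have card: "card D = card ?E + 2"
      using card_Diff_subset[of "{x, M x}" D] card_mono[of D "{x, M x}"] less.prems(1) x by simp
    have "even (card ?E) \<longleftrightarrow> even (card {y \<in> ?E. M y = y})"
      by (rule less.hyps) (use card less.prems E in auto)
    moreover have "{y \<in> ?E. M y = y} = {y \<in> D. M y = y}"
      using x less.prems by auto
    ultimately show ?thesis using card by simp
  qed
qed

lemma finite_disagreement_involutions:
  assumes M: "\<And>x. x \<in> X \<Longrightarrow> M x \<in> X" "\<And>x. x \<in> X \<Longrightarrow> M (M x) = x"
    and N: "\<And>x. x \<in> X \<Longrightarrow> N x \<in> X" "\<And>x. x \<in> X \<Longrightarrow> N (N x) = x"
    and finN: "finite {x \<in> X. N x = x}"
    and cut: "\<And>S. S \<subseteq> X \<Longrightarrow> M ` S \<subseteq> S \<Longrightarrow> finite {x \<in> S. N x \<notin> S}"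
  shows "finite {x \<in> X. M x \<noteq> N x}"
proof (rule ccontr)
  assume "infinite {x \<in> X. M x \<noteq> N x}"
  \<comment> \<open>Discarding the fixed points of \<open>N\<close> makes \<open>N x\<close> differ
    from \<open>x\<close> as well as from \<open>M x\<close>. This covers the pair of a point with
    itself, about which the colouring says nothing.\<close>
  define Z where "Z = {x \<in> X. M x \<noteq> N x} - {x \<in> X. N x = x}"
  have "infinite Z" unfolding Z_def
    using \<open>infinite {x \<in> X. M x \<noteq> N x}\<close> finN by (rule Diff_infinite_finite[rotated])
  \<comment> \<open>Colour pairs by \<open>bad\<close>. A bad clique is finite because each vertex has at most three bad
    neighbours, so Ramsey gives an infinite \<open>Y\<close> without bad pairs, whose \<open>M\<close>-closure violates \<open>cut\<close>.\<close>
  define bad where "bad x y \<longleftrightarrow> N x = y \<or> N x = M y" for x y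
  define c :: "'a set \<Rightarrow> nat" where "c e = (if \<exists>x y. e = {x, y} \<and> bad x y then 1 else 0)" for e
  have "\<forall>x\<in>Z. \<forall>y\<in>Z. x \<noteq> y \<longrightarrow> c {x, y} < 2" by (simp add: c_def)
  from Ramsey2[OF \<open>infinite Z\<close> this]
  obtain Y t where Y: "Y \<subseteq> Z" "infinite Y"
    and hom: "\<forall>x\<in>Y. \<forall>y\<in>Y. x \<noteq> y \<longrightarrow> c {x, y} = t"
    by (elim exE conjE) (rule that)
  have YX: "Y \<subseteq> X" using Y(1) by (auto simp: Z_def)
  have good: "\<not> bad x y" if xy: "x \<in> Y" "y \<in> Y" "x \<noteq> y" for x y
  proof
    assume "bad x y"
    then have "c {x, y} = 1" by (auto simp: c_def)
    then have t: "t = 1" using hom[rule_format, OF xy] by simp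
    \<comment> \<open>\<open>bad\<close> is not symmetric while \<open>c\<close> colours unordered
      pairs, so both orders count: \<open>bad x z\<close> yields \<open>N x\<close> and
      \<open>M (N x)\<close>, and \<open>bad z x\<close> yields \<open>N x\<close> and
      \<open>N (M x)\<close>.\<close>
    have "Y \<subseteq> {x, N x, M (N x), N (M x)}"
    proof
      fix z assume z: "z \<in> Y"
      show "z \<in> {x, N x, M (N x), N (M x)}"
      proof (cases "z = x")
        case False
        then have "c {x, z} = 1" using hom[rule_format, OF xy(1) z] t by simp
        then obtain p q where "{x, z} = {p, q}" "bad p q"
          unfolding c_def by (metis zero_neq_one)
        then have "bad x z \<or> bad z x" by (auto simp: doubleton_eq_iff)
        then show ?thesis unfolding bad_def using M N z xy YX
          by (metis insert_iff subsetD)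
      qed simp
    qed
    then show False using Y(2) finite_subset by blast
  qed
  define S where "S = Y \<union> M ` Y"
  have "finite {x \<in> S. N x \<notin> S}"
    by (rule cut) (use M YX in \<open>auto simp: S_def\<close>)
  moreover have "Y \<subseteq> {x \<in> S. N x \<notin> S}"
  proof
    fix x assume x: "x \<in> Y"
    have "N x \<noteq> y" "N x \<noteq> M y" if "y \<in> Y" for y
      using good[OF x that] subsetD[OF Y(1) x] by (cases "x = y"; auto simp: bad_def Z_def)+
    then show "x \<in> {x \<in> S. N x \<notin> S}" using x by (auto simp: S_def)
  qed
  ultimately show False using Y(2) finite_subset by blast
qed

lemma even_card_fixed_points_involutions:
  assumes M: "\<And>x. x \<in> X \<Longrightarrow> M x \<in> X" "\<And>x. x \<in> X \<Longrightarrow> M (M x) = x"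
    and N: "\<And>x. x \<in> X \<Longrightarrow> N x \<in> X" "\<And>x. x \<in> X \<Longrightarrow> N (N x) = x"
    and finM: "finite {x \<in> X. M x = x}" and finN: "finite {x \<in> X. N x = x}"
    and cut: "\<And>S. S \<subseteq> X \<Longrightarrow> M ` S \<subseteq> S \<Longrightarrow> finite {x \<in> S. N x \<notin> S}"
  shows "even (card {x \<in> X. M x = x}) \<longleftrightarrow> even (card {x \<in> X. N x = x})"
proof -
  define D where "D = {x \<in> X. M x \<noteq> N x}"
  have "finite D" unfolding D_def
    by (rule finite_disagreement_involutions) (use assms in auto)
  have split: "card {x \<in> X. K x = x} = card {x \<in> X - D. K x = x} + card {x \<in> D. K x = x}"
    if "finite {x \<in> X. K x = x}" for K
  proof -
    have "{x \<in> X. K x = x} = {x \<in> X - D. K x = x} \<union> {x \<in> D. K x = x}" by (auto simp: D_def)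
    then show ?thesis using that card_Un_disjoint[of "{x \<in> X - D. K x = x}" "{x \<in> D. K x = x}"]
      by auto
  qed
  have "{x \<in> X - D. M x = x} = {x \<in> X - D. N x = x}" by (auto simp: D_def)
  \<comment> \<open>\<open>D\<close> is closed under \<open>M\<close>: if
    \<open>N (M x) = M (M x) = x\<close>, then applying \<open>N\<close> gives
    \<open>M x = N x\<close>. The same holds with \<open>M\<close> and \<open>N\<close>
    exchanged.\<close>
  moreover have "even (card D) \<longleftrightarrow> even (card {x \<in> D. M x = x})"
    by (rule even_card_involution[OF \<open>finite D\<close>]) (use M N in \<open>auto simp: D_def\<close>, metis)
  moreover have "even (card D) \<longleftrightarrow> even (card {x \<in> D. N x = x})"
    by (rule even_card_involution[OF \<open>finite D\<close>]) (use M N in \<open>auto simp: D_def\<close>, metis)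
  ultimately show ?thesis using split[OF finM] split[OF finN] by simp
qed

section \<open>Relative atoms and representatives of classes\<close>

text \<open>The algebra of sets modulo finite sets is itself atomless, so atoms are taken relative
  to a subset \<open>F\<close>.\<close>

definition atoms_in :: "'a::boolean_algebra set \<Rightarrow> 'a set" where
  "atoms_in F = {a \<in> F. a \<noteq> bot \<and> (\<forall>b\<in>F. b \<le> a \<longrightarrow> b = bot \<or> b = a)}"

lemma atom_le_atom_eq: "a \<in> atoms_in F \<Longrightarrow> b \<in> atoms_in F \<Longrightarrow> a \<le> b \<Longrightarrow> a = b"
  unfolding atoms_in_def by blast

lemma fin_class_eq_iff: "fin_class A = fin_class B \<longleftrightarrow> finite (A - B) \<and> finite (B - A)"
  by (simp add: pnat_fin.abs_eq_iff eq_fin_def)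

lemma fin_class_le_iff: "fin_class A \<le> fin_class B \<longleftrightarrow> finite (A - B)"
  by (simp add: less_eq_pnat_fin.abs_eq)

lemma fin_class_eq_bot_iff: "fin_class A = bot \<longleftrightarrow> finite A"
  by (simp add: bot_pnat_fin_def fin_class_eq_iff)

lemma fin_class_cases: obtains A where "a = fin_class A"
  by (induct a rule: pnat_fin.abs_induct) blast

section \<open>Invariant sets of an injection with cofinite range\<close>

locale cofinite_injection =
  fixes h :: "nat \<Rightarrow> nat"
  assumes inj: "inj h" and cofinite: "finite (- range h)"
begin

text \<open>A set is fixed modulo finite by the automorphism that \<open>h\<close> induces iff its \<open>cut\<close> is
  finite.\<close>

definition cut :: "nat set \<Rightarrow> nat set" where
  "cut A = {x. (x \<in> A) \<noteq> (h x \<in> A)}"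

definition invariant_classes :: "pnat_fin set" where
  "invariant_classes = fin_class ` {A. finite (cut A)}"

text \<open>Two points are equivalent when their forward iterates meet. This avoids the inverse of
  \<open>h\<close>, which is only partial.\<close>

definition orbit :: "nat \<Rightarrow> nat set" where
  "orbit x = {y. \<exists>m n. (h ^^ m) x = (h ^^ n) y}"

lemma funpow_eq_iff: "(h ^^ n) x = (h ^^ n) y \<longleftrightarrow> x = y"
  using inj_fn[OF inj, of n] by (simp add: inj_eq)

lemma finite_cut_Int: "finite (cut A) \<Longrightarrow> finite (cut B) \<Longrightarrow> finite (cut (A \<inter> B))"
  by (rule finite_subset[of _ "cut A \<union> cut B"]) (auto simp: cut_def)

text \<open>Finiteness of the cut depends only on the class: a change of the set on a finite
  \<open>D\<close> alters the cut only on \<open>D\<close> and its preimage under \<open>h\<close>,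
  which is finite by injectivity.\<close>

lemma fin_class_in_invariant_classes_iff: "fin_class A \<in> invariant_classes \<longleftrightarrow> finite (cut A)"
proof
  assume "fin_class A \<in> invariant_classes"
  then obtain B where B: "finite (cut B)" "finite (A - B)" "finite (B - A)"
    by (auto simp: invariant_classes_def fin_class_eq_iff)
  let ?D = "(A - B) \<union> (B - A)"
  have "finite (h -` ?D)" using B inj by (intro finite_vimageI) auto
  then have "finite (cut B \<union> ?D \<union> h -` ?D)" using B by blast
  then show "finite (cut A)" by (rule rev_finite_subset) (auto simp: cut_def)
qed (auto simp: invariant_classes_def)

lemma fin_class_atomI:
  assumes "infinite A" "finite (cut A)"
    and "\<And>B. finite (cut B) \<Longrightarrow> finite (A \<inter> B) \<or> finite (A - B)"
  shows "fin_class A \<in> atoms_in invariant_classes"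
  unfolding atoms_in_def
proof (intro CollectI conjI ballI impI)
  fix b assume b: "b \<in> invariant_classes" "b \<le> fin_class A"
  obtain B where B: "b = fin_class B" by (rule fin_class_cases)
  have "finite (cut B)" "finite (B - A)"
    using b unfolding B fin_class_in_invariant_classes_iff fin_class_le_iff by auto
  with assms(3)[of B] show "b = bot \<or> b = fin_class A"
    unfolding B fin_class_eq_bot_iff fin_class_eq_iff
    using finite_subset[of B "(A \<inter> B) \<union> (B - A)"] by blast
qed (use assms in \<open>simp_all add: fin_class_in_invariant_classes_iff fin_class_eq_bot_iff\<close>)

text \<open>Every \<open>B\<close> with finite cut may be tested, not only those below
  \<open>A\<close>, because \<open>A \<inter> B\<close> again has a finite cut.\<close>

lemma fin_class_atomD:
  assumes "fin_class A \<in> atoms_in invariant_classes"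
  shows "infinite A" "finite (cut A)" "finite (cut B) \<Longrightarrow> finite (A \<inter> B) \<or> finite (A - B)"
proof -
  show "infinite A" and cut: "finite (cut A)"
    using assms by (auto simp: atoms_in_def fin_class_in_invariant_classes_iff fin_class_eq_bot_iff)
  assume "finite (cut B)"
  then have "fin_class (A \<inter> B) \<in> invariant_classes"
    using cut by (simp add: fin_class_in_invariant_classes_iff finite_cut_Int)
  moreover have "fin_class (A \<inter> B) \<le> fin_class A" 
    by (auto simp: fin_class_le_iff intro: finite_subset[of _ "{}"])
  ultimately have "fin_class (A \<inter> B) = bot \<or> fin_class (A \<inter> B) = fin_class A"
    using assms by (auto simp: atoms_in_def)
  then show "finite (A \<inter> B) \<or> finite (A - B)"
    by (auto simp: fin_class_eq_bot_iff fin_class_eq_iff Diff_Int)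
qed

section \<open>Orbits\<close>

lemma orbit_refl [simp]: "x \<in> orbit x"
  unfolding orbit_def by blast

lemma orbit_sym: "y \<in> orbit x \<Longrightarrow> x \<in> orbit y"
  unfolding orbit_def by (force intro: sym)

lemma orbit_trans:
  assumes "y \<in> orbit x" "z \<in> orbit y" shows "z \<in> orbit x"
proof -
  obtain m n k l where 1: "(h ^^ m) x = (h ^^ n) y" and 2: "(h ^^ k) y = (h ^^ l) z"
    using assms unfolding orbit_def by blast
  have "(h ^^ (k + m)) x = (h ^^ k) ((h ^^ n) y)" using 1 by (simp add: funpow_add)
  also have "\<dots> = (h ^^ n) ((h ^^ k) y)" by (metis add.commute comp_apply funpow_add)
  also have "\<dots> = (h ^^ (n + l)) z" using 2 by (simp add: funpow_add)
  finally show ?thesis unfolding orbit_def by blast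
qed

lemma orbit_eq: "y \<in> orbit x \<Longrightarrow> orbit y = orbit x"
  by (intro equalityI subsetI) (erule (1) orbit_trans, erule orbit_trans[OF orbit_sym])

lemma funpow_in_orbit [simp]: "(h ^^ n) x \<in> orbit x"
proof -
  have "(h ^^ n) x = (h ^^ 0) ((h ^^ n) x)" by simp
  then show ?thesis unfolding orbit_def by blast
qed

lemma orbit_h_iff [simp]: "h y \<in> orbit x \<longleftrightarrow> y \<in> orbit x"
proof -
  have "h y \<in> orbit y" using funpow_in_orbit[of 1 y] by simp
  then show ?thesis using orbit_eq[of "h y" y] orbit_sym[of _ x] orbit_eq[of x] orbit_sym[of x] by metis
qed

lemma cut_orbit [simp]: "cut (orbit x) = {}"
  by (simp add: cut_def)

text \<open>Membership in \<open>A\<close> changes between \<open>x\<close> and \<open>h x\<close>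
  only at points of \<open>cut A\<close>, and any two points of an orbit are joined by steps of
  \<open>h\<close>.\<close>

lemma orbit_in_or_out:
  assumes "orbit x \<inter> cut A = {}" shows "orbit x \<subseteq> A \<or> orbit x \<inter> A = {}"
proof -
  have *: "(h ^^ n) y \<in> A \<longleftrightarrow> y \<in> A" if "y \<in> orbit x" for n y
  proof (induction n)
    case (Suc n)
    have "(h ^^ n) y \<in> orbit x" by (rule orbit_trans[OF that funpow_in_orbit])
    then show ?case using Suc assms by (auto simp: cut_def)
  qed simp
  have "y \<in> A \<longleftrightarrow> x \<in> A" if "y \<in> orbit x" for y
  proof -
    obtain m n where "(h ^^ m) x = (h ^^ n) y" using \<open>y \<in> orbit x\<close> by (auto simp: orbit_def)
    then show ?thesis using *[OF orbit_refl, of m] *[OF that, of n] by simp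
  qed
  then show ?thesis by blast
qed

text \<open>An orbit that \<open>A\<close> splits contains a point of \<open>cut A\<close> and is
  the orbit of that point.\<close>

lemma finite_split_orbits:
  assumes "finite (cut A)"
  shows "finite {P \<in> range orbit. \<not> P \<subseteq> A \<and> P \<inter> A \<noteq> {}}"
proof (rule finite_subset)
  show "{P \<in> range orbit. \<not> P \<subseteq> A \<and> P \<inter> A \<noteq> {}} \<subseteq> orbit ` cut A"
  proof
    fix P assume P: "P \<in> {P \<in> range orbit. \<not> P \<subseteq> A \<and> P \<inter> A \<noteq> {}}"
    then obtain x where x: "P = orbit x" by blast
    then obtain y where y: "y \<in> orbit x" "y \<in> cut A" using P orbit_in_or_out[of x A] by blast
    then show "P \<in> orbit ` cut A" using x orbit_eq[OF y(1)] by blast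
  qed
qed (use assms in blast)

text \<open>By injectivity the cycle through \<open>x\<close> is closed under \<open>h\<close> in
  both directions, so it contains the whole orbit.\<close>

lemma finite_orbit_if_periodic:
  assumes "(h ^^ p) x = x" "0 < p" shows "finite (orbit x)"
proof (rule finite_subset)
  have bwd: "z \<in> (\<lambda>i. (h ^^ i) x) ` {..<p}" if hz: "h z \<in> (\<lambda>i. (h ^^ i) x) ` {..<p}" for z
  proof -
    obtain i where i: "h z = (h ^^ i) x" "i < p" using hz by blast
    show ?thesis
    proof (cases i)
      \<comment> \<open>The cycle closes up here: the predecessor of \<open>x\<close> is its iterate
        \<open>p - 1\<close>.\<close>
      case 0
      then have "h z = h ((h ^^ (p - 1)) x)"
        using i assms by (metis Suc_diff_1 comp_apply funpow.simps(2) funpow_0)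
      then have "z = (h ^^ (p - 1)) x" using inj by (simp add: inj_eq)
      then show ?thesis using assms(2) by auto
    next
      case (Suc j)
      then have "z = (h ^^ j) x" using i inj by (simp add: inj_eq)
      then show ?thesis using Suc i by auto
    qed
  qed
  have fwd: "h z \<in> (\<lambda>i. (h ^^ i) x) ` {..<p}" if hz: "z \<in> (\<lambda>i. (h ^^ i) x) ` {..<p}" for z
  proof -
    obtain i where i: "z = (h ^^ i) x" "i < p" using hz by blast
    then have "h z = (h ^^ Suc i) x" by simp
    moreover have "(h ^^ Suc i) x \<in> (\<lambda>i. (h ^^ i) x) ` {..<p}"
    proof (cases "Suc i = p")
      case True
      then have "(h ^^ Suc i) x = (h ^^ 0) x" using assms(1) by simp
      then show ?thesis using assms(2) by blast
    next
      case False
      then have "Suc i < p" using i(2) by simp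
      then show ?thesis by blast
    qed
    ultimately show ?thesis by simp
  qed
  have "orbit x \<inter> cut ((\<lambda>i. (h ^^ i) x) ` {..<p}) = {}"
    unfolding cut_def using bwd fwd by blast
  moreover have "x \<in> (\<lambda>i. (h ^^ i) x) ` {..<p}"
    using assms(2) by (intro image_eqI[of _ _ 0]) auto
  ultimately show "orbit x \<subseteq> (\<lambda>i. (h ^^ i) x) ` {..<p}" 
    using orbit_in_or_out[of x "(\<lambda>i. (h ^^ i) x) ` {..<p}"] orbit_refl[of x] by blast
qed simp

section \<open>Rays and their classes\<close>

text \<open>The range of a ray is one end of an infinite orbit; the second alternative runs backwards along
  \<open>h\<close>.\<close>

definition ray :: "(nat \<Rightarrow> nat) \<Rightarrow> bool" where
  "ray s \<longleftrightarrow> inj s \<and> ((\<forall>n. s (Suc n) = h (s n)) \<or> (\<forall>n. h (s (Suc n)) = s n))"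

text \<open>The range of a ray can be entered or left along \<open>h\<close> only at
  \<open>s 0\<close>: a forward ray contributes at most the preimage of \<open>s 0\<close>, a
  backward ray at most \<open>s 0\<close> itself.\<close>

lemma finite_cut_ray:
  assumes "ray s" shows "finite (cut (range s))"
proof -
  have "finite (h -` {s 0})" using inj by (intro finite_vimageI) auto
  then have "finite (insert (s 0) (h -` {s 0}))" by blast
  moreover have "cut (range s) \<subseteq> insert (s 0) (h -` {s 0})"
  proof
    fix x assume x: "x \<in> cut (range s)"
    consider "\<forall>n. s (Suc n) = h (s n)" | "\<forall>n. h (s (Suc n)) = s n" using assms ray_def by blast
    then show "x \<in> insert (s 0) (h -` {s 0})"
    proof cases
      case 1
      have "x \<notin> range s" using x 1 by (auto simp: cut_def) (metis rangeI)
      then obtain n where n: "h x = s n" using x by (auto simp: cut_def)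
      show ?thesis
      proof (cases n)
        case (Suc k)
        then have "x = s k" using n 1 inj by (simp add: inj_eq)
        then show ?thesis using \<open>x \<notin> range s\<close> by blast
      qed (use n in auto)
    next
      case 2
      have "h x \<notin> range s"
      proof
        assume "h x \<in> range s"
        then obtain n where "h x = h (s (Suc n))" using 2 by auto
        then have "x \<in> range s" using inj by (auto simp: inj_eq)
        then show False using x \<open>h x \<in> range s\<close> by (simp add: cut_def)
      qed
      then obtain n where n: "x = s n" using x by (auto simp: cut_def)
      show ?thesis
      proof (cases n)
        case (Suc k)
        then show ?thesis using n 2 \<open>h x \<notin> range s\<close> by auto
      qed (use n in auto)
    qed
  qed
  ultimately show ?thesis using finite_subset by blast
qed

text \<open>Membership in \<open>A\<close> changes only finitely often along the ray, hence is
  constant from some index \<open>k\<close> on.\<close>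

lemma ray_in_or_out:
  assumes "ray s" "finite (cut A)" shows "finite (range s \<inter> A) \<or> finite (range s - A)"
proof -
  have "inj s" using assms ray_def by blast
  \<comment> \<open>A forward ray records a change between \<open>s n\<close> and
    \<open>s (Suc n)\<close> at \<open>s n\<close>, a backward ray at
    \<open>s (Suc n)\<close>.\<close>
  have "finite (s -` cut A \<union> (s \<circ> Suc) -` cut A)"
    using assms(2) \<open>inj s\<close> by (intro finite_UnI finite_vimageI inj_compose) auto
  moreover have "{n. (s n \<in> A) \<noteq> (s (Suc n) \<in> A)} \<subseteq> s -` cut A \<union> (s \<circ> Suc) -` cut A"
    using assms(1) unfolding ray_def cut_def by auto
  ultimately have "finite {n. (s n \<in> A) \<noteq> (s (Suc n) \<in> A)}" using finite_subset by blast
  then obtain k where k: "\<And>n. (s n \<in> A) \<noteq> (s (Suc n) \<in> A) \<Longrightarrow> n < k"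
    by (auto simp: finite_nat_set_iff_bounded)
  have const: "s n \<in> A \<longleftrightarrow> s k \<in> A" if "k \<le> n" for n
    using that by (induction n rule: dec_induct) (use k in force)+
  show ?thesis
  proof (cases "s k \<in> A")
    case True
    then have "n < k" if "s n \<notin> A" for n using that const[of n] not_less by blast
    then have "range s - A \<subseteq> s ` {..<k}" by blast
    then show ?thesis using finite_subset by blast
  next
    case False
    then have "n < k" if "s n \<in> A" for n using that const[of n] not_less by blast
    then have "range s \<inter> A \<subseteq> s ` {..<k}" by blast
    then show ?thesis using finite_subset by blast
  qed
qed

lemma ray_atom:
  assumes "ray s" shows "fin_class (range s) \<in> atoms_in invariant_classes"
  using finite_cut_ray[OF assms] ray_in_or_out[OF assms] assms
  by (intro fin_class_atomI) (auto simp: ray_def dest: range_inj_infinite)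

abbreviation ends :: "pnat_fin set" where
  "ends \<equiv> atoms_in invariant_classes"

section \<open>Decomposition of infinite orbits into rays\<close>

lemma periodicD:
  assumes "(h ^^ m) x = (h ^^ n) x" "m < n" shows "(h ^^ (n - m)) x = x"
proof -
  have "(h ^^ m) ((h ^^ (n - m)) x) = (h ^^ n) x"
    using assms(2) by (metis comp_apply funpow_add le_add_diff_inverse less_imp_le)
  then show ?thesis using assms(1) funpow_eq_iff by metis
qed

lemma funpow_eq_iff_infinite_orbit:
  assumes "infinite (orbit x)" shows "(h ^^ m) x = (h ^^ n) x \<longleftrightarrow> m = n"
proof -
  have False if "(h ^^ m) x = (h ^^ n) x" "m < n" for m n
    using finite_orbit_if_periodic[OF periodicD[OF that]] that(2) assms by simp
  then show ?thesis by (metis nat_neq_iff)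
qed

lemma forward_ray:
  assumes "infinite (orbit x)" shows "ray (\<lambda>n. (h ^^ n) x)"
  using funpow_eq_iff_infinite_orbit[OF assms] by (simp add: ray_def inj_def)

text \<open>A repetition among the iterates would make \<open>x\<close> periodic and hence a value
  of \<open>h\<close>.\<close>

lemma infinite_orbit_source:
  assumes "x \<notin> range h" shows "infinite (orbit x)"
proof
  assume fin: "finite (orbit x)"
  have "range (\<lambda>n. (h ^^ n) x) \<subseteq> orbit x" by auto
  then have "\<not> inj (\<lambda>n. (h ^^ n) x)" using fin finite_subset range_inj_infinite by blast
  then obtain m n where "(h ^^ m) x = (h ^^ n) x" "m < n"
    unfolding inj_def by (metis nat_neq_iff)
  from periodicD[OF this] have "x = h ((h ^^ (n - m - 1)) x)"
    using \<open>m < n\<close> by (metis Suc_diff_1 comp_apply funpow.simps(2) zero_less_diff)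
  then show False using assms by blast
qed

text \<open>A point outside the range of \<open>h\<close> has no predecessor, so its whole orbit
  lies ahead of it.\<close>

lemma orbit_source:
  assumes "x \<notin> range h" shows "orbit x = range (\<lambda>n. (h ^^ n) x)"
proof (intro equalityI subsetI)
  fix y assume "y \<in> orbit x"
  then obtain m n where mn: "(h ^^ m) x = (h ^^ n) y" unfolding orbit_def by blast
  show "y \<in> range (\<lambda>n. (h ^^ n) x)"
  proof (cases "n \<le> m")
    case True
    then have "(h ^^ n) ((h ^^ (m - n)) x) = (h ^^ n) y"
      using mn by (metis comp_apply funpow_add le_add_diff_inverse)
    then have "(h ^^ (m - n)) x = y" by (simp only: funpow_eq_iff)
    then show ?thesis by blast
  next
    case False
    then have "(h ^^ m) ((h ^^ (n - m)) y) = (h ^^ m) x"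
      using mn by (metis comp_apply funpow_add le_add_diff_inverse linear)
    then have "(h ^^ (n - m)) y = x" by (simp only: funpow_eq_iff)
    moreover obtain k where "n - m = Suc k" using False by (metis Suc_diff_Suc not_le)
    ultimately have "x = h ((h ^^ k) y)" by simp
    then show ?thesis using assms by blast
  qed
qed auto

text \<open>From \<open>x\<close> the orbit can be followed for ever both along \<open>h\<close>
  and, since no point of it lacks a predecessor, against \<open>h\<close>.\<close>

lemma orbit_two_rays:
  assumes inf: "infinite (orbit x)" and sub: "orbit x \<subseteq> range h"
  obtains s t where "ray s" "ray t" "orbit x = range s \<union> range t" "range s \<inter> range t = {}"
proof -
  \<comment> \<open>\<open>inv h\<close> is total but undoes \<open>h\<close> only on
    \<open>range h\<close>; the assumption \<open>sub\<close> keeps all iterates of \<open>g\<close>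
    inside the orbit, where it can be trusted.\<close>
  define g where "g = inv h"
  have hg: "h (g y) = y" if "y \<in> orbit x" for y
    using that sub unfolding g_def by (meson f_inv_into_f subsetD)
  have g_orbit: "(g ^^ n) x \<in> orbit x" for n
  proof (induction n)
    case (Suc n)
    then have "h ((g ^^ Suc n) x) \<in> orbit x" using hg by simp
    then show ?case by (simp only: orbit_h_iff)
  qed simp
  have hngn: "(h ^^ n) ((g ^^ n) x) = x" for n
  proof (induction n)
    case (Suc n)
    have "(h ^^ Suc n) ((g ^^ Suc n) x) = (h ^^ n) (h (g ((g ^^ n) x)))"
      by (simp only: funpow_Suc_right[of n h] funpow.simps(2)[of n g] comp_apply)
    then show ?case using Suc hg[OF g_orbit[of n]] by simp
  qed simp
  \<comment> \<open>The backward ray starts at the predecessor of \<open>x\<close>, since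
    \<open>x\<close> itself belongs to \<open>t\<close> and the two ranges must be disjoint.\<close>
  define s where "s n = (g ^^ Suc n) x" for n
  define t where "t n = (h ^^ n) x" for n
  have "s m \<noteq> s n" if "m < n" for m n
  proof
    assume eq: "s m = s n"
    have "(h ^^ Suc m) (s m) = (h ^^ Suc n) (s m)"
      using hngn[of "Suc m"] hngn[of "Suc n"] eq by (simp only: s_def)
    moreover have "infinite (orbit (s m))"
      using orbit_eq[OF g_orbit[of "Suc m"]] inf by (simp add: s_def)
    ultimately show False using funpow_eq_iff_infinite_orbit[of "s m" "Suc m" "Suc n"] that by simp
  qed
  then have "inj s" unfolding inj_def by (metis nat_neq_iff)
  moreover have "h (s (Suc n)) = s n" for n
    using hg[OF g_orbit[of "Suc n"]] by (simp add: s_def)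
  ultimately have "ray s" by (simp add: ray_def)
  moreover have "ray t" using forward_ray[OF inf] unfolding t_def .
  moreover have "s m \<noteq> t n" for m n
  proof
    assume "s m = t n"
    then have "(h ^^ Suc m) (t n) = x" using hngn[of "Suc m"] by (simp only: s_def)
    then have "(h ^^ (Suc m + n)) x = (h ^^ 0) x" unfolding t_def by (simp add: funpow_add)
    then show False using funpow_eq_iff_infinite_orbit[OF inf, of "Suc m + n" 0] by simp
  qed
  then have "range s \<inter> range t = {}" by blast
  moreover have "orbit x = range s \<union> range t"
  proof (intro equalityI subsetI)
    fix y assume "y \<in> orbit x"
    then obtain m n where mn: "(h ^^ m) x = (h ^^ n) y" unfolding orbit_def by blast
    show "y \<in> range s \<union> range t"
    proof (cases "n \<le> m")
      case True
      then have "(h ^^ n) (t (m - n)) = (h ^^ n) y"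
        using mn unfolding t_def by (metis comp_apply funpow_add le_add_diff_inverse)
      then have "t (m - n) = y" by (simp only: funpow_eq_iff)
      then show ?thesis by blast
    next
      case False
      then have "(h ^^ m) ((h ^^ (n - m)) y) = (h ^^ m) x"
        using mn by (metis comp_apply funpow_add le_add_diff_inverse linear)
      then have "(h ^^ (n - m)) y = (h ^^ (n - m)) ((g ^^ (n - m)) x)"
        by (simp only: funpow_eq_iff hngn)
      then have "y = (g ^^ (n - m)) x" by (simp only: funpow_eq_iff)
      moreover obtain k where "n - m = Suc k" using False by (metis Suc_diff_Suc not_le)
      ultimately have "y = s k" by (simp only: s_def)
      then show ?thesis by blast
    qed
  next
    fix y assume "y \<in> range s \<union> range t"
    then obtain n where "y = (g ^^ Suc n) x \<or> y = (h ^^ n) x" unfolding s_def t_def by blast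
    then show "y \<in> orbit x" using g_orbit funpow_in_orbit by blast
  qed
  ultimately show ?thesis using that by blast
qed

section \<open>Ends below the class of an orbit\<close>

definition orbit_class :: "nat \<Rightarrow> pnat_fin" where
  "orbit_class x = fin_class (orbit x)"

lemma infinite_orbit_if_end_le:
  assumes "a \<in> ends" "a \<le> orbit_class x" shows "infinite (orbit x)"
proof
  assume "finite (orbit x)"
  then have "orbit_class x = bot" by (simp add: orbit_class_def fin_class_eq_bot_iff)
  then show False using assms by (auto simp: atoms_in_def bot_unique)
qed

text \<open>Distinct orbits are disjoint, so an end below both would be the zero class.\<close>

lemma orbit_eq_if_end_le:
  assumes "a \<in> ends" "a \<le> orbit_class x" "a \<le> orbit_class y" shows "orbit x = orbit y"
proof (rule ccontr)
  assume "orbit x \<noteq> orbit y"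
  then have disj: "orbit x \<inter> orbit y = {}" using orbit_eq by blast
  obtain A where A: "a = fin_class A" by (rule fin_class_cases)
  have "finite (A - orbit x)" "finite (A - orbit y)"
    using assms by (simp_all add: A orbit_class_def fin_class_le_iff)
  then have "finite A"
    using finite_subset[of A "(A - orbit x) \<union> (A - orbit y)"] disj by blast
  then show False using fin_class_atomD(1) assms(1) A by blast
qed

lemma orbit_class_source:
  assumes "x \<notin> range h" shows "orbit_class x \<in> ends"
  unfolding orbit_class_def orbit_source[OF assms]
  by (rule ray_atom[OF forward_ray[OF infinite_orbit_source[OF assms]]])

text \<open>The ends are the classes of the two disjoint rays. The difference equations have the
  form in which \<open>partner\<close> computes the other end.\<close>

lemma two_ends:
  assumes "infinite (orbit x)" "orbit x \<subseteq> range h"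
  obtains p q where "p \<in> ends" "q \<in> ends" "p \<noteq> q" "orbit_class x = sup p q"
    "orbit_class x - p = q" "orbit_class x - q = p"
proof -
  obtain s t where st: "ray s" "ray t" "orbit x = range s \<union> range t" "range s \<inter> range t = {}"
    by (rule orbit_two_rays[OF assms])
  show thesis
  proof (rule that[of "fin_class (range s)" "fin_class (range t)"])
    show "fin_class (range s) \<in> ends" "fin_class (range t) \<in> ends"
      using st by (auto intro: ray_atom)
    have "range s - range t = range s" using st by blast
    moreover have "infinite (range s)" using st(1) by (simp add: ray_def range_inj_infinite)
    ultimately show "fin_class (range s) \<noteq> fin_class (range t)" by (simp add: fin_class_eq_iff)
    show "orbit_class x = sup (fin_class (range s)) (fin_class (range t))"
      by (simp add: orbit_class_def st(3) sup_pnat_fin.abs_eq)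
    have "orbit x - range s = range t" "orbit x - range t = range s" using st by blast+
    then show "orbit_class x - fin_class (range s) = fin_class (range t)"
        "orbit_class x - fin_class (range t) = fin_class (range s)"
      by (simp_all add: orbit_class_def minus_pnat_fin.abs_eq)
  qed
qed

text \<open>Representatives of \<open>p\<close> and \<open>q\<close> cannot split that of
  \<open>a\<close> into two infinite pieces, so \<open>a\<close> lies below one of them, and
  comparable atoms are equal.\<close>

lemma end_le_sup:
  assumes a: "a \<in> ends" "a \<le> sup p q" and pq: "p \<in> ends" "q \<in> ends"
  shows "a = p \<or> a = q"
proof -
  obtain A P Q where eq: "a = fin_class A" "p = fin_class P" "q = fin_class Q"
    by (metis fin_class_cases)
  have PQ: "finite (cut P)" "finite (cut Q)" using fin_class_atomD(2) pq eq by blast+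
  have "finite (A - (P \<union> Q))"
    using a(2) by (simp add: eq sup_pnat_fin.abs_eq fin_class_le_iff)
  moreover have "infinite A" using a(1) fin_class_atomD(1) eq by blast
  ultimately have "infinite (A \<inter> P) \<or> infinite (A \<inter> Q)"
    using finite_subset[of A "(A - (P \<union> Q)) \<union> (A \<inter> P) \<union> (A \<inter> Q)"] by blast
  then have "finite (A - P) \<or> finite (A - Q)"
    using fin_class_atomD(3)[of A] a(1) PQ eq(1) by blast
  then have "a \<le> p \<or> a \<le> q" by (simp add: eq fin_class_le_iff)
  then show ?thesis using atom_le_atom_eq a(1) pq by blast
qed

text \<open>Otherwise a representative \<open>A\<close> meets every orbit in a finite set. As it
  splits only finitely many orbits, it is, up to a finite set, a union of infinitely many finite
  orbits. Two disjoint infinite families of these orbits then split it into two infinite invariant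
  pieces.\<close>

lemma end_le_orbit_class:
  assumes "a \<in> ends" shows "\<exists>x. a \<le> orbit_class x"
proof (rule ccontr)
  assume none: "\<nexists>x. a \<le> orbit_class x"
  obtain A where A: "a = fin_class A" by (rule fin_class_cases)
  note atom = fin_class_atomD[OF assms[unfolded A]]
  have fin: "finite (A \<inter> orbit x)" for x
    using none atom(3)[of "orbit x"] by (auto simp: A orbit_class_def fin_class_le_iff)
  define A' where "A' = {x. orbit x \<subseteq> A}"
  have sub: "A' \<subseteq> A" unfolding A'_def using orbit_refl by blast
  define S where "S = {P \<in> range orbit. \<not> P \<subseteq> A \<and> P \<inter> A \<noteq> {}}"
  have "A - A' \<subseteq> (\<Union>P\<in>S. A \<inter> P)"
    unfolding A'_def S_def using orbit_refl by blast
  moreover have "finite (\<Union>P\<in>S. A \<inter> P)"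
  proof (rule finite_UN_I)
    show "finite S" using finite_split_orbits[OF atom(2)] unfolding S_def .
    show "finite (A \<inter> P)" if "P \<in> S" for P using that fin unfolding S_def by blast
  qed
  ultimately have "finite (A - A')" using finite_subset by blast
  then have infA': "infinite A'"
    using atom(1) finite_subset[of A "A' \<union> (A - A')"] by blast
  have infO: "infinite (orbit ` A')"
  proof
    assume "finite (orbit ` A')"
    moreover have "finite P" if "P \<in> orbit ` A'" for P
      using that fin by (auto simp: A'_def) (metis Int_absorb1)
    ultimately have "finite (\<Union>(orbit ` A'))" by blast
    moreover have "A' \<subseteq> \<Union>(orbit ` A')" using orbit_refl by blast
    ultimately show False using infA' finite_subset by blast
  qed
  then obtain P Q where PQ: "P \<union> Q \<subseteq> orbit ` A'" "P \<inter> Q = {}" "infinite P" "infinite Q"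
  proof -
    obtain C :: "nat \<Rightarrow> nat set set" where C: "pairwise (\<lambda>i j. disjnt (C i) (C j)) UNIV"
      "(\<Union>i. C i) \<subseteq> orbit ` A'" "\<And>i. infinite (C i)"
      using infinite_infinite_partition[OF infO] by blast
    have "C 0 \<inter> C 1 = {}" using C(1) by (simp add: pairwise_def disjnt_def)
    then show thesis using that[of "C 0" "C 1"] C(2,3) by blast
  qed
  have disj: "\<Union>P \<inter> \<Union>Q = {}"
  proof -
    have "p = q" if "p \<in> orbit ` A'" "q \<in> orbit ` A'" "z \<in> p" "z \<in> q" for p q z
      using that orbit_eq by blast
    note same = this
    show ?thesis
    proof (rule ccontr)
      assume "\<Union>P \<inter> \<Union>Q \<noteq> {}"
      then obtain p q z where "p \<in> P" "q \<in> Q" "z \<in> p" "z \<in> q" by blast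
      moreover from this have "p = q" by (intro same) (use PQ(1) in auto)
      ultimately show False using PQ(2) by blast
    qed
  qed
  have inf: "infinite (\<Union>P)" "infinite (\<Union>Q)"
    using PQ(3,4) by (auto dest: finite_UnionD)
  have "\<Union>P \<union> \<Union>Q \<subseteq> A" using PQ(1) unfolding A'_def by blast
  then have "A \<inter> \<Union>P = \<Union>P" "\<Union>Q \<subseteq> A - \<Union>P" using disj by blast+
  then have "infinite (A \<inter> \<Union>P)" "infinite (A - \<Union>P)" 
    using inf finite_subset[of "\<Union>Q" "A - \<Union>P"] by auto
  moreover have "cut (\<Union>P) = {}"
  proof -
    have "h y \<in> p \<longleftrightarrow> y \<in> p" if "p \<in> P" for p y
      using that PQ(1) orbit_h_iff by blast
    then show ?thesis unfolding cut_def by blast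
  qed
  ultimately show False using atom(3)[of "\<Union>P"] by simp
qed

section \<open>The involution exchanging the ends of each orbit\<close>

text \<open>The other end of the same orbit, or \<open>a\<close> itself if the orbit has only one end.\<close>

definition partner :: "pnat_fin \<Rightarrow> pnat_fin" where
  "partner a = (let c = orbit_class (SOME x. a \<le> orbit_class x) in if c = a then a else c - a)"

text \<open>The choice made in \<open>partner\<close> is harmless, because an end lies below the
  class of only one orbit.\<close>

lemma partner_eq:
  assumes "a \<in> ends" "a \<le> orbit_class x"
  shows "partner a = (if orbit_class x = a then a else orbit_class x - a)"
proof -
  have "a \<le> orbit_class (SOME x. a \<le> orbit_class x)" using assms(2) by (rule someI)
  then have "orbit_class (SOME x. a \<le> orbit_class x) = orbit_class x"
    using orbit_eq_if_end_le[OF assms(1) _ assms(2)] by (simp add: orbit_class_def)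
  then show ?thesis by (simp add: partner_def)
qed

text \<open>An orbit with a point outside \<open>range h\<close> has its own class as its only end;
  any other orbit with an end has exactly two, the classes of its rays.\<close>

lemma partner_props:
  assumes a: "a \<in> ends" "a \<le> orbit_class x"
  shows "partner a \<in> ends \<and> partner a \<le> orbit_class x \<and> partner (partner a) = a \<and>
    {b \<in> ends. b \<le> orbit_class x} = {a, partner a} \<and> (partner a = a \<longleftrightarrow> \<not> orbit x \<subseteq> range h)"
proof (cases "orbit x \<subseteq> range h")
  case False
  then obtain y where y: "y \<in> orbit x" "y \<notin> range h" by blast
  have "orbit_class x = orbit_class y" using orbit_eq[OF y(1)] by (simp add: orbit_class_def)
  then have "orbit_class x \<in> ends" using orbit_class_source[OF y(2)] by simp
  then have only: "b = orbit_class x" if "b \<in> ends" "b \<le> orbit_class x" for b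
    using that atom_le_atom_eq by blast
  then have "a = orbit_class x" using a .
  moreover have "partner a = a" using partner_eq[OF a] calculation by simp
  ultimately show ?thesis using a only False by auto
next
  case True
  obtain p q where pq: "p \<in> ends" "q \<in> ends" "p \<noteq> q" "orbit_class x = sup p q"
    "orbit_class x - p = q" "orbit_class x - q = p"
    by (rule two_ends[OF infinite_orbit_if_end_le[OF a] True])
  have le: "p \<le> orbit_class x" "q \<le> orbit_class x" using pq(4) by simp_all
  \<comment> \<open>If the class of the orbit were one of the two ends, the other end would lie
    below that atom.\<close>
  have "orbit_class x \<noteq> p" "orbit_class x \<noteq> q"
    using le pq(1-3) atom_le_atom_eq by metis+
  then have "partner p = q" "partner q = p"
    using partner_eq[OF pq(1) le(1)] partner_eq[OF pq(2) le(2)] pq(5,6) by simp_all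
  moreover have only: "b = p \<or> b = q" if "b \<in> ends" "b \<le> orbit_class x" for b
    using end_le_sup[OF _ _ pq(1,2), of b] that pq(4) by simp
  moreover have "{b \<in> ends. b \<le> orbit_class x} = {p, q}"
    using only pq(1,2) le by blast
  moreover have "a = p \<or> a = q" using only[OF a] .
  ultimately show ?thesis
    using pq(1-3) le True by (elim disjE) (simp_all add: insert_commute)
qed

lemma partner_in_ends: "a \<in> ends \<Longrightarrow> partner a \<in> ends"
  using end_le_orbit_class partner_props by blast

lemma partner_partner: "a \<in> ends \<Longrightarrow> partner (partner a) = a"
  using end_le_orbit_class partner_props by blast

text \<open>This turns the number of fixed ends into \<open>card (- range h)\<close>. The map is
  injective because a point outside the range is not a proper iterate, so an orbit contains at most
  one.\<close>

lemma bij_betw_sources_fixed_ends: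
  "bij_betw orbit_class (- range h) {a \<in> ends. partner a = a}"
proof (rule bij_betw_imageI)
  show "inj_on orbit_class (- range h)"
  proof (rule inj_onI)
    fix x y assume x: "x \<in> - range h" and y: "y \<in> - range h" and eq: "orbit_class x = orbit_class y"
    have "orbit x = orbit y"
      using orbit_eq_if_end_le[OF orbit_class_source[of x]] x eq by simp
    then have "y \<in> range (\<lambda>n. (h ^^ n) x)" using orbit_source[of x] x orbit_refl[of y] by simp
    then obtain n where "y = (h ^^ n) x" by blast
    with y show "x = y" by (cases n) auto
  qed
  show "orbit_class ` (- range h) = {a \<in> ends. partner a = a}"
  proof (intro equalityI subsetI)
    fix a assume "a \<in> orbit_class ` (- range h)"
    then obtain x where x: "x \<notin> range h" "a = orbit_class x" by blast
    have "a \<in> ends" using orbit_class_source[OF x(1)] x(2) by simp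
    moreover have "\<not> orbit x \<subseteq> range h" using x(1) orbit_refl by blast
    ultimately show "a \<in> {a \<in> ends. partner a = a}" using partner_props[of a x] x(2) by simp
  next
    fix a assume "a \<in> {a \<in> ends. partner a = a}"
    then have a: "a \<in> ends" "partner a = a" by auto
    obtain x where x: "a \<le> orbit_class x" using end_le_orbit_class[OF a(1)] ..
    then obtain y where y: "y \<in> orbit x" "y \<notin> range h" using partner_props[OF a(1) x] a(2) by blast
    have "orbit_class x = orbit_class y" using orbit_eq[OF y(1)] by (simp add: orbit_class_def)
    then have "a = orbit_class y"
      using x atom_le_atom_eq[OF a(1) orbit_class_source[OF y(2)]] by simp
    then show "a \<in> orbit_class ` (- range h)" using y(2) by blast
  qed
qed

text \<open>The union of all orbits lying over \<open>S\<close> serves as a representative: its cut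
  is empty, and closure under \<open>partner\<close> ensures that these orbits bring in no further
  ends.\<close>

lemma partner_closed_set_realised:
  assumes S: "S \<subseteq> ends" "partner ` S \<subseteq> S"
  shows "\<exists>u \<in> invariant_classes. {a \<in> ends. a \<le> u} = S"
proof -
  define U where "U = {x. \<exists>a\<in>S. a \<le> orbit_class x}"
  have same: "y \<in> U \<longleftrightarrow> x \<in> U" if "y \<in> orbit x" for x y
    using orbit_eq[OF that] by (simp add: U_def orbit_class_def)
  have "h x \<in> U \<longleftrightarrow> x \<in> U" for x by (rule same) simp
  then have "cut U = {}" by (simp add: cut_def)
  then have "fin_class U \<in> invariant_classes" by (simp add: fin_class_in_invariant_classes_iff)
  moreover have "{a \<in> ends. a \<le> fin_class U} = S"
  proof (intro equalityI subsetI)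
    fix a assume a: "a \<in> S"
    then have "a \<in> ends" using S(1) by blast
    then obtain x where x: "a \<le> orbit_class x" using end_le_orbit_class by blast
    have "x \<in> U" unfolding U_def using a x by blast
    then have "orbit x \<subseteq> U" using same by blast
    then have "orbit_class x \<le> fin_class U"
      by (simp add: orbit_class_def fin_class_le_iff Diff_eq_empty_iff[THEN iffD2])
    then show "a \<in> {a \<in> ends. a \<le> fin_class U}" using x \<open>a \<in> ends\<close> by auto
  next
    fix a assume "a \<in> {a \<in> ends. a \<le> fin_class U}"
    then have a: "a \<in> ends" "a \<le> fin_class U" by auto
    obtain x where x: "a \<le> orbit_class x" using end_le_orbit_class[OF a(1)] ..
    have "x \<in> U"
    proof (rule ccontr)
      assume "x \<notin> U"
      then have disj: "orbit x \<inter> U = {}" using same by blast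
      obtain A where A: "a = fin_class A" by (rule fin_class_cases)
      have "finite (A - orbit x)" "finite (A - U)"
        using a(2) x by (simp_all add: A orbit_class_def fin_class_le_iff)
      then have "finite A" using finite_subset[of A "(A - orbit x) \<union> (A - U)"] disj by blast
      then show False using fin_class_atomD(1) a(1) A by blast
    qed
    then obtain b where b: "b \<in> S" "b \<le> orbit_class x" unfolding U_def by blast
    then have "a \<in> {b, partner b}" using partner_props[of b x] S(1) a(1) x by blast
    then show "a \<in> S" using b(1) S(2) by blast
  qed
  ultimately show ?thesis by blast
qed

text \<open>Such an end lies below an orbit that a representative of \<open>d\<close> splits; there
  are finitely many of these orbits, each with at most two ends.\<close>

lemma finite_separated_ends:
  assumes "d \<in> invariant_classes"
  shows "finite {a \<in> ends. a \<le> d \<and> \<not> partner a \<le> d}"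
proof -
  obtain D where D: "d = fin_class D" by (rule fin_class_cases)
  have cut: "finite (cut D)" using assms by (simp add: D fin_class_in_invariant_classes_iff)
  define S where "S = {P \<in> range orbit. \<not> P \<subseteq> D \<and> P \<inter> D \<noteq> {}}"
  have "{a \<in> ends. a \<le> d \<and> \<not> partner a \<le> d} \<subseteq> (\<Union>P\<in>S. {a \<in> ends. a \<le> fin_class P})"
  proof
    fix a assume "a \<in> {a \<in> ends. a \<le> d \<and> \<not> partner a \<le> d}"
    then have a: "a \<in> ends" "a \<le> d" "\<not> partner a \<le> d" by auto
    obtain x where x: "a \<le> orbit_class x" using end_le_orbit_class[OF a(1)] ..
    have "\<not> orbit x \<subseteq> D"
    proof
      assume "orbit x \<subseteq> D"
      then have "orbit_class x \<le> d"
        by (simp add: D orbit_class_def fin_class_le_iff Diff_eq_empty_iff[THEN iffD2])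
      then show False using partner_props[OF a(1) x] a(3) order_trans by blast
    qed
    moreover have "orbit x \<inter> D \<noteq> {}"
    proof
      assume disj: "orbit x \<inter> D = {}"
      obtain A where A: "a = fin_class A" by (rule fin_class_cases)
      have "finite (A - orbit x)" "finite (A - D)"
        using a(2) x by (simp_all add: A D orbit_class_def fin_class_le_iff)
      then have "finite A" using finite_subset[of A "(A - orbit x) \<union> (A - D)"] disj by blast
      then show False using fin_class_atomD(1) a(1) A by blast
    qed
    ultimately have "orbit x \<in> S" by (simp add: S_def)
    then show "a \<in> (\<Union>P\<in>S. {a \<in> ends. a \<le> fin_class P})"
      using a(1) x unfolding orbit_class_def by blast
  qed
  moreover have "finite (\<Union>P\<in>S. {a \<in> ends. a \<le> fin_class P})"
  proof (rule finite_UN_I)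
    show "finite S" using finite_split_orbits[OF cut] unfolding S_def .
    fix P assume "P \<in> S"
    then obtain x where P: "fin_class P = orbit_class x" unfolding S_def orbit_class_def by blast
    show "finite {a \<in> ends. a \<le> fin_class P}"
    proof (cases "{a \<in> ends. a \<le> fin_class P} = {}")
      case True
      then show ?thesis by (simp only: finite.emptyI)
    next
      case False
      then obtain a where "a \<in> ends" "a \<le> orbit_class x" using P by auto
      from partner_props[OF this] show ?thesis unfolding P by simp
    qed
  qed
  ultimately show ?thesis using finite_subset by blast
qed

end

section \<open>From almost permutations to injections\<close>

text \<open>By injectivity an edge of the graph of \<open>f\<close> is determined by its target. Up
  to points outside the range, the targets of the edges that cross \<open>A\<close> form the
  symmetric difference of \<open>A\<close> and its image.\<close>

lemma induced_fin_class_eq_iff: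
  assumes f: "almost_permutation f"
  shows "induced f (fin_class A) = fin_class A \<longleftrightarrow>
    finite {(x, y). f x = Some y \<and> (x \<in> A) \<noteq> (y \<in> A)}" (is "_ \<longleftrightarrow> finite ?E")
proof -
  have fr: "finite (- ran f)" and inj: "inj_on f (dom f)"
    using f by (auto simp: almost_permutation_def)
  have inj': "x = x'" if "f x = Some y" "f x' = Some y" for x x' y
    using inj that by (auto simp: inj_on_def dom_def)
  let ?D = "(ran (f |` A) - A) \<union> (A - ran (f |` A))"
  have "inj_on snd ?E" by (auto simp: inj_on_def intro: inj')
  have "snd ` ?E \<subseteq> ?D"
  proof
    fix y assume "y \<in> snd ` ?E"
    then obtain x where x: "f x = Some y" "(x \<in> A) \<noteq> (y \<in> A)" by auto
    have "y \<in> ran (f |` A) \<longleftrightarrow> x \<in> A" unfolding ran_restrict_iff using inj'[OF x(1)] x(1) by metis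
    then show "y \<in> ?D" using x(2) by blast
  qed
  moreover have "?D \<subseteq> snd ` ?E \<union> - ran f"
  proof
    fix y assume y: "y \<in> ?D"
    show "y \<in> snd ` ?E \<union> - ran f"
    proof (cases "y \<in> ran f")
      case True
      then obtain x where x: "f x = Some y" by (auto simp: ran_def)
      have "y \<in> ran (f |` A) \<longleftrightarrow> x \<in> A" unfolding ran_restrict_iff using inj'[OF x] x by metis
      then have "(x, y) \<in> ?E" using x y by auto
      from imageI[OF this, of snd] show ?thesis by (simp only: snd_conv UnI1)
    qed simp
  qed
  ultimately have "finite ?D \<longleftrightarrow> finite (snd ` ?E)"
    using fr finite_subset by (metis (no_types, lifting) finite_Un)
  also have "\<dots> \<longleftrightarrow> finite ?E" using \<open>inj_on snd ?E\<close> by (rule finite_image_iff)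
  finally show ?thesis by (simp add: induced.abs_eq fin_class_eq_iff)
qed

text \<open>The missing domain is mapped injectively into the missing range. A relation is used
  instead of a partial map so that the result applies to a graph and to its converse alike.\<close>

lemma extend_to_injection:
  fixes E :: "(nat \<times> nat) set"
  assumes sv: "single_valued E" "single_valued (E\<inverse>)"
    and fin: "finite (- Domain E)" "finite (- Range E)"
    and card: "card (- Domain E) \<le> card (- Range E)"
  obtains h where "inj h" "card (- Range E) = card (- range h) + card (- Domain E)"
    "finite (- range h)" "E \<subseteq> {(x, h x) |x. True}" "finite ({(x, h x) |x. True} - E)"
proof -
  obtain e where e: "e ` (- Domain E) \<subseteq> - Range E" "inj_on e (- Domain E)"
    using card_le_inj[OF fin card] by blast
  define h where "h x = (if x \<in> Domain E then THE y. (x, y) \<in> E else e x)" for x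
  have h_E: "h x = y" if "(x, y) \<in> E" for x y
    unfolding h_def using that sv(1) by (auto simp: single_valued_def intro!: the_equality)
  have h_e: "h x = e x" if "x \<notin> Domain E" for x using that by (simp add: h_def)
  have E_h: "(x, h x) \<in> E" if "x \<in> Domain E" for x using that h_E by auto
  have "inj h"
  proof (rule injI)
    fix x y assume eq: "h x = h y"
    consider "x \<in> Domain E" "y \<in> Domain E" | "x \<in> Domain E" "y \<notin> Domain E"
      | "x \<notin> Domain E" "y \<in> Domain E" | "x \<notin> Domain E" "y \<notin> Domain E" by blast
    then show "x = y"
    proof cases
      case 1
      then show ?thesis using E_h[OF 1(1)] E_h[OF 1(2)] eq sv(2) by (auto simp: single_valued_def)
    next
      case 2
      then show ?thesis using E_h[OF 2(1)] h_e[OF 2(2)] eq e(1) by auto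
    next
      case 3
      then show ?thesis using E_h[OF 3(2)] h_e[OF 3(1)] eq e(1) by (metis ComplD ComplI RangeI image_subset_iff)
    next
      case 4
      then show ?thesis using eq h_e e(2) by (simp add: inj_on_def)
    qed
  qed
  moreover have "- Range E = - range h \<union> e ` (- Domain E)"
  proof (intro equalityI subsetI)
    fix y assume y: "y \<in> - Range E"
    show "y \<in> - range h \<union> e ` (- Domain E)"
    proof (cases "y \<in> range h")
      case True
      then obtain x where "y = h x" by blast
      then show ?thesis using y E_h[of x] h_e[of x] by (cases "x \<in> Domain E") auto
    qed simp
  next
    fix y assume "y \<in> - range h \<union> e ` (- Domain E)"
    moreover have "y \<in> range h" if "(x, y) \<in> E" for x using h_E[OF that] by blast
    ultimately show "y \<in> - Range E" using e(1) by blast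
  qed
  moreover have "- range h \<inter> e ` (- Domain E) = {}" 
  proof -
    have "e x \<in> range h" if "x \<in> - Domain E" for x using h_e[of x] that by (metis ComplD rangeI)
    then show ?thesis by blast
  qed
  ultimately have "finite (- range h)"
    "card (- Range E) = card (- range h) + card (- Domain E)"
    using fin card_Un_disjoint[of "- range h" "e ` (- Domain E)"] card_image[OF e(2)]
    by (metis finite_Un, metis finite_Un)
  moreover have "E \<subseteq> {(x, h x) |x. True}" using h_E by auto
  moreover have "{(x, h x) |x. True} - E \<subseteq> (\<lambda>x. (x, h x)) ` (- Domain E)" using E_h by auto
  then have "finite ({(x, h x) |x. True} - E)" using fin(1) finite_subset by blast
  ultimately show ?thesis using that \<open>inj h\<close> by blast
qed

text \<open>The graph of \<open>f\<close>, or its converse if the index is positive, extends to a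
  total injection by finitely many edges, which does not affect whether finitely many edges cross a
  set. Passing to the converse only changes the sign of the index.\<close>

lemma induced_fixed_classes_eq_invariant_classes:
  assumes f: "almost_permutation f"
  obtains h where "cofinite_injection h"
    "cofinite_injection.invariant_classes h = {a. induced f a = a}"
    "even (card (- range h)) \<longleftrightarrow> par (induced f) = 0"
proof -
  define E where "E = {(x, y). f x = Some y}"
  \<comment> \<open>Reversing edges does not change \<open>dis\<close>: this is why \<open>h\<close> may extend the inverse of \<open>f\<close>
    when the index is positive.\<close>
  define dis where "dis R A = {(x, y) \<in> R. (x \<in> A) \<noteq> (y \<in> A)}"
    for R :: "(nat \<times> nat) set" and A
  have fr: "finite (- ran f)" and fd: "finite (- dom f)" and inj: "inj_on f (dom f)"
    using f by (auto simp: almost_permutation_def)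
  have dom: "Domain E = dom f" and ran: "Range E = ran f" by (auto simp: E_def ran_def)
  have sv: "single_valued E" "single_valued (E\<inverse>)"
    using inj by (auto simp: E_def single_valued_def inj_on_def dom_def)
  have fixed: "induced f (fin_class A) = fin_class A \<longleftrightarrow> finite (dis E A)" for A
  proof -
    have "dis E A = {(x, y). f x = Some y \<and> (x \<in> A) \<noteq> (y \<in> A)}" by (auto simp: dis_def E_def)
    then show ?thesis using induced_fin_class_eq_iff[OF f] by simp
  qed
  have invariant: "cofinite_injection.invariant_classes h = {a. induced f a = a}"
    if h: "inj h" "finite (- range h)" "R \<subseteq> {(x, h x) |x. True}" "finite ({(x, h x) |x. True} - R)"
      and R: "R = E \<or> R = E\<inverse>" for h R
  proof -
    interpret cofinite_injection h using h(1,2) by unfold_locales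
    have "finite (cut A) \<longleftrightarrow> finite (dis E A)" for A
    proof -
      have "dis {(x, h x) |x. True} A = (\<lambda>x. (x, h x)) ` cut A" by (auto simp: dis_def cut_def)
      moreover have "inj_on (\<lambda>x. (x, h x)) (cut A)" by (simp add: inj_on_def)
      ultimately have "finite (cut A) \<longleftrightarrow> finite (dis {(x, h x) |x. True} A)"
        by (simp add: finite_image_iff)
      also have "\<dots> \<longleftrightarrow> finite (dis R A)"
      proof
        assume "finite (dis {(x, h x) |x. True} A)"
        then show "finite (dis R A)"
          by (rule rev_finite_subset) (use h(3) in \<open>auto simp: dis_def\<close>)
      next
        assume "finite (dis R A)"
        then have "finite (dis R A \<union> ({(x, h x) |x. True} - R))" using h(4) by blast
        then show "finite (dis {(x, h x) |x. True} A)"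
          by (rule rev_finite_subset) (auto simp: dis_def)
      qed
      also have "\<dots> \<longleftrightarrow> finite (dis E A)"
      proof -
        have "dis (E\<inverse>) A = (dis E A)\<inverse>" by (auto simp: dis_def)
        then show ?thesis using R by auto
      qed
      finally show ?thesis .
    qed
    then have *: "fin_class A \<in> invariant_classes \<longleftrightarrow> induced f (fin_class A) = fin_class A" for A
      by (simp add: fin_class_in_invariant_classes_iff fixed)
    have "a \<in> invariant_classes \<longleftrightarrow> induced f a = a" for a
      by (rule fin_class_cases[of a]) (simp add: *)
    then show ?thesis by blast
  qed
  show thesis
  proof (cases "card (- Domain E) \<le> card (- Range E)")
    case True
    obtain h where h: "inj h" "card (- Range E) = card (- range h) + card (- Domain E)"
      "finite (- range h)" "E \<subseteq> {(x, h x) |x. True}" "finite ({(x, h x) |x. True} - E)"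
      by (rule extend_to_injection[of E]) (use sv fr fd dom ran True in auto)
    have "index f = - int (card (- range h))" using h(2) by (simp add: index_def dom ran)
    then have "even (card (- range h)) \<longleftrightarrow> par (induced f) = 0" by (simp add: par_induced[OF f])
    then show thesis
      using that[of h] invariant[of h E] h by (simp add: cofinite_injection_def)
  next
    case False
    obtain h where h: "inj h" "card (- Range (E\<inverse>)) = card (- range h) + card (- Domain (E\<inverse>))"
      "finite (- range h)" "E\<inverse> \<subseteq> {(x, h x) |x. True}" "finite ({(x, h x) |x. True} - E\<inverse>)"
      by (rule extend_to_injection[of "E\<inverse>"]) (use sv fr fd dom ran False in auto)
    have "index f = int (card (- range h))" using h(2) by (simp add: index_def dom ran)
    then have "even (card (- range h)) \<longleftrightarrow> par (induced f) = 0" by (simp add: par_induced[OF f])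
    then show thesis
      using that[of h] invariant[of h "E\<inverse>"] h by (simp add: cofinite_injection_def)
  qed
qed

section \<open>Transport along the conjugacy\<close>

lemma boolean_automorphism_le_iff:
  assumes "boolean_automorphism \<gamma>" shows "\<gamma> x \<le> \<gamma> y \<longleftrightarrow> x \<le> y"
proof -
  have "inf (\<gamma> x) (\<gamma> y) = \<gamma> x \<longleftrightarrow> inf x y = x"
    using assms unfolding boolean_automorphism_def bij_def by (metis injD)
  then show ?thesis by (simp add: le_iff_inf)
qed

lemma boolean_automorphism_atoms_in:
  assumes "boolean_automorphism \<gamma>" "\<And>a. \<gamma> a \<in> G \<longleftrightarrow> a \<in> F"
  shows "\<gamma> a \<in> atoms_in G \<longleftrightarrow> a \<in> atoms_in F"
proof -
  have bij: "bij \<gamma>" and bot: "\<gamma> bot = bot" using assms(1) by (auto simp: boolean_automorphism_def)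
  have eq: "\<gamma> x = \<gamma> y \<longleftrightarrow> x = y" for x y using bij by (auto simp: bij_def inj_eq)
  have eqbot: "\<gamma> x = bot \<longleftrightarrow> x = bot" for x using eq[of x bot] bot by simp
  \<comment> \<open>By surjectivity \<open>b\<close> may be taken to run over the values of
    \<gamma>, after which every condition can be pulled back along \<gamma>.\<close>
  have "(\<forall>b\<in>G. b \<le> \<gamma> a \<longrightarrow> b = bot \<or> b = \<gamma> a) \<longleftrightarrow>
      (\<forall>b. \<gamma> b \<in> G \<longrightarrow> \<gamma> b \<le> \<gamma> a \<longrightarrow> \<gamma> b = bot \<or> \<gamma> b = \<gamma> a)"
    using bij_pointE[OF bij] by metis
  then show ?thesis
    by (auto simp: atoms_in_def assms(2) eq eqbot boolean_automorphism_le_iff[OF assms(1)])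
qed

theorem theorem3p6:
  fixes \<alpha> \<beta> :: "pnat_fin \<Rightarrow> pnat_fin"
  assumes "trivial_automorphism \<alpha>"
    and "trivial_automorphism \<beta>"
    and "par \<alpha> \<noteq> par \<beta>"
  shows "\<not> conjugate \<alpha> \<beta>"
proof
  assume "conjugate \<alpha> \<beta>"
  then obtain \<gamma> where \<gamma>: "boolean_automorphism \<gamma>" "\<gamma> \<circ> \<alpha> = \<beta> \<circ> \<gamma>" unfolding conjugate_def by blast
  obtain f where f: "almost_permutation f" "\<alpha> = induced f"
    using assms(1) unfolding trivial_automorphism_def by blast
  obtain g where g: "almost_permutation g" "\<beta> = induced g"
    using assms(2) unfolding trivial_automorphism_def by blast
  obtain h where h: "cofinite_injection h"
    "cofinite_injection.invariant_classes h = {a. \<alpha> a = a}"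
    "even (card (- range h)) \<longleftrightarrow> par \<alpha> = 0"
    using induced_fixed_classes_eq_invariant_classes[OF f(1)] f(2) by metis
  obtain k where k: "cofinite_injection k"
    "cofinite_injection.invariant_classes k = {a. \<beta> a = a}"
    "even (card (- range k)) \<longleftrightarrow> par \<beta> = 0"
    using induced_fixed_classes_eq_invariant_classes[OF g(1)] g(2) by metis
  interpret H: cofinite_injection h by (rule h(1))
  interpret K: cofinite_injection k by (rule k(1))
  have bij: "bij \<gamma>" using \<gamma>(1) by (simp add: boolean_automorphism_def)
  have inv1: "inv \<gamma> (\<gamma> a) = a" and inv2: "\<gamma> (inv \<gamma> a) = a" for a
    using bij by (simp_all add: bij_def surj_f_inv_f)
  have eq: "\<gamma> x = \<gamma> y \<longleftrightarrow> x = y" for x y using bij by (auto simp: bij_def inj_eq)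
  have comm: "\<gamma> (\<alpha> a) = \<beta> (\<gamma> a)" for a using \<gamma>(2) by (metis comp_apply)
  have inv_cls: "\<gamma> a \<in> K.invariant_classes \<longleftrightarrow> a \<in> H.invariant_classes" for a
    by (simp add: h(2) k(2) comm[symmetric] eq)
  have ends: "\<gamma> a \<in> K.ends \<longleftrightarrow> a \<in> H.ends" for a
    by (rule boolean_automorphism_atoms_in[OF \<gamma>(1) inv_cls])
  define N where "N a = inv \<gamma> (K.partner (\<gamma> a))" for a
  have \<gamma>N: "\<gamma> (N a) = K.partner (\<gamma> a)" for a by (simp add: N_def inv2)
  have bijH: "bij_betw H.orbit_class (- range h) {a \<in> H.ends. H.partner a = a}"
    by (rule H.bij_betw_sources_fixed_ends)
  have "bij_betw \<gamma> {a \<in> H.ends. N a = a} {a \<in> K.ends. K.partner a = a}"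
  proof (rule bij_betw_imageI)
    show "inj_on \<gamma> {a \<in> H.ends. N a = a}" by (simp add: inj_on_def eq)
    show "\<gamma> ` {a \<in> H.ends. N a = a} = {a \<in> K.ends. K.partner a = a}"
    proof (intro equalityI subsetI)
      fix b assume "b \<in> \<gamma> ` {a \<in> H.ends. N a = a}"
      then obtain a where a: "a \<in> H.ends" "N a = a" "b = \<gamma> a" by blast
      then show "b \<in> {a \<in> K.ends. K.partner a = a}" using ends[of a] \<gamma>N[of a] by simp
    next
      fix b assume "b \<in> {a \<in> K.ends. K.partner a = a}"
      then have "inv \<gamma> b \<in> {a \<in> H.ends. N a = a}" using ends[of "inv \<gamma> b"] by (simp add: inv2 N_def)
      then show "b \<in> \<gamma> ` {a \<in> H.ends. N a = a}" using inv2[of b] by (metis image_eqI)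
    qed
  qed
  \<comment> \<open>The points outside \<open>range k\<close> correspond to the fixed ends of
    \<open>k\<close>, and these are pulled back along \<gamma> to the fixed points of
    \<open>N\<close>.\<close>
  from bij_betw_trans[OF K.bij_betw_sources_fixed_ends bij_betw_inv_into[OF this]]
  obtain \<phi> where bijK: "bij_betw \<phi> (- range k) {a \<in> H.ends. N a = a}" by (rule that)
  have "even (card {a \<in> H.ends. H.partner a = a}) \<longleftrightarrow> even (card {a \<in> H.ends. N a = a})"
  proof (rule even_card_fixed_points_involutions)
    show "H.partner a \<in> H.ends" "H.partner (H.partner a) = a" if "a \<in> H.ends" for a
      using that by (rule H.partner_in_ends, rule H.partner_partner)
    show "N a \<in> H.ends" if "a \<in> H.ends" for a
      using K.partner_in_ends[of "\<gamma> a"] ends[of a] ends[of "N a"] that \<gamma>N[of a] by simp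
    show "N (N a) = a" if "a \<in> H.ends" for a
      using K.partner_partner[of "\<gamma> a"] ends[of a] that by (simp add: N_def inv1 inv2)
    show "finite {a \<in> H.ends. H.partner a = a}" 
      using bij_betw_finite[OF bijH] H.cofinite by (rule iffD1)
    show "finite {a \<in> H.ends. N a = a}" 
      using bij_betw_finite[OF bijK] K.cofinite by (rule iffD1)
    fix S assume S: "S \<subseteq> H.ends" "H.partner ` S \<subseteq> S"
    then obtain u where u: "u \<in> H.invariant_classes" "{a \<in> H.ends. a \<le> u} = S"
      using H.partner_closed_set_realised by blast
    \<comment> \<open>Since \<open>u\<close> realises \<open>S\<close>, an end of \<open>S\<close>
      that \<open>N\<close> moves out of \<open>S\<close> is sent by \<gamma> to an end that the
      invariant class \<open>\<gamma> u\<close> separates from its partner for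
      \<open>k\<close>.\<close>
    have "\<gamma> ` {a \<in> S. N a \<notin> S} \<subseteq> {b \<in> K.ends. b \<le> \<gamma> u \<and> \<not> K.partner b \<le> \<gamma> u}"
    proof
      fix b assume "b \<in> \<gamma> ` {a \<in> S. N a \<notin> S}"
      then obtain a where a: "b = \<gamma> a" "a \<in> S" "N a \<notin> S" by blast
      have aE: "a \<in> H.ends" "a \<le> u" using a(2) u(2) by auto
      have bE: "b \<in> K.ends" using ends[of a] a(1) aE(1) by simp
      have "K.partner b = \<gamma> (N a)" using \<gamma>N a(1) by simp
      moreover have "N a \<in> H.ends"
        using K.partner_in_ends[OF bE] ends[of "N a"] \<gamma>N[of a] a(1) by simp
      then have "\<not> N a \<le> u" using a(3) u(2) by blast
      ultimately have "\<not> K.partner b \<le> \<gamma> u" by (simp add: boolean_automorphism_le_iff[OF \<gamma>(1)])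
      moreover have "b \<le> \<gamma> u" using a(1) aE(2) by (simp add: boolean_automorphism_le_iff[OF \<gamma>(1)])
      ultimately show "b \<in> {b \<in> K.ends. b \<le> \<gamma> u \<and> \<not> K.partner b \<le> \<gamma> u}" using bE by simp
    qed
    moreover have "finite {b \<in> K.ends. b \<le> \<gamma> u \<and> \<not> K.partner b \<le> \<gamma> u}"
      by (rule K.finite_separated_ends) (use inv_cls u(1) in simp)
    ultimately have "finite (\<gamma> ` {a \<in> S. N a \<notin> S})" using finite_subset by blast
    then show "finite {a \<in> S. N a \<notin> S}" by (rule finite_imageD) (simp add: inj_on_def eq)
  qed
  moreover have "card (- range h) = card {a \<in> H.ends. H.partner a = a}"
    using bijH by (rule bij_betw_same_card)
  moreover have "card (- range k) = card {a \<in> H.ends. N a = a}"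
    using bijK by (rule bij_betw_same_card)
  ultimately have "par \<alpha> = 0 \<longleftrightarrow> par \<beta> = 0" using h(3) k(3) by simp
  moreover have "par \<alpha> = 0 \<or> par \<alpha> = 1" "par \<beta> = 0 \<or> par \<beta> = 1"
    using par_induced[OF f(1)] par_induced[OF g(1)] f(2) g(2) by auto
  ultimately show False using assms(3) by auto
qed

end
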